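(* Let $I,J\subseteq\mathbb R$ be open intervals, let $a:I\to\mathbb R$ and $b:J\to\mathbb R$ be arbitrary continuous functions and let $z$ be a nonzero real number. Put $$\Xi(x):=\exp\left(-\int^x a(\xi)\,\mathrm d\xi\right),\qquad \omega=\frac{\Xi(x)}{y}\,\mathrm dx\wedge\mathrm dy\quad\text{on } I\times(\mathbb R\setminus\{0\}).$$ (i) The deformation of the $t$-dependent generalized Buchdahl Hamiltonian $h_t=y\,\Xi(x)-b(t)\int^x\Xi(\xi)\,\mathrm d\xi$ (the deformation being defined by the change of variables described in the context) is, in terms of the variables $(x,y)$, $$h_{z,t}=h_{z,1}+b(t)\,h_{z,2},\qquad h_{z,1}=y\,\Xi(x),\qquad h_{z,2}=\frac{\exp\bigl(-zy\,\Xi(x)\bigr)-1}{zy\,\Xi(x)}\int^x\Xi(\xi)\,\mathrm d\xi,$$ and $$\{h_{z,2},h_{z,1}\}_\omega=\frac{\mathrm e^{-zh_{z,1}}-1}{z}.$$ (ii) The corresponding deformation of the generalized Buchdahl system $\dot x=y,\ \dot y=a(x)y^2+b(t)y$, i.e. the system of Hamilton equations of $h_{z,t}$ with respect to $\omega$, is $$\begin{aligned} \frac{\mathrm dx}{\mathrm dt}&=\{x,h_{z,t}\}_\omega=y+b(t)\left(\frac{\exp\bigl(zy\,\Xi(x)\bigr)-1-zy\,\Xi(x)}{zy\,\Xi^2(x)}\right)\exp\bigl(-zy\,\Xi(x)\bigr)\int^x\Xi(\xi)\,\mathrm d\xi,\\ \frac{\mathrm dy}{\mathrm dt}&=\{y,h_{z,t}\}_\omega=a(x)y^2+b(t)\exp\bigl(-zy\,\Xi(x)\bigr)\\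 &\quad\times\left(\frac{\exp\bigl(zy\,\Xi(x)\bigr)-1}{z\,\Xi(x)}+\frac{\exp\bigl(zy\,\Xi(x)\bigr)-1-zy\,\Xi(x)}{z\,\Xi^2(x)}\,a(x)\int^x\Xi(\xi)\,\mathrm d\xi\right). \end{aligned}$$
   Context: Indefinite integrals $\int^x(\cdot)\,\mathrm d\xi$ denote antiderivatives of the integrand, chosen once and for all; thus $\Xi>0$ and $\Xi'=-a\,\Xi$. The Poisson bracket of $\omega$ is $$\{f,g\}_\omega=\frac{y}{\Xi(x)}\left(\frac{\partial f}{\partial x}\frac{\partial g}{\partial y}-\frac{\partial f}{\partial y}\frac{\partial g}{\partial x}\right),\qquad y\neq0.$$ Definition of the deformation. In canonical coordinates $(q,p)$ with $\omega_{\rm can}=\mathrm dq\wedge\mathrm dp$, the quantum book algebra $\mathfrak b_{z,2}$ (generators $v_1,v_2$, commutator $[v_2,v_1]_z=-(1-\mathrm e^{-zv_1})/z$) is represented by the functions $$h_{z,1}=-q,\qquad h_{z,2}=\frac{\mathrm e^{zq}-1}{z}\,p,$$ which for $z\to0$ become $h_1=-q$, $h_2=qp$. The deformed functions in the variables $(x,y)$ are those obtained from these by the change of variables $$q=-y\,\Xi(x),\qquad p=\frac{1}{y\,\Xi(x)}\int^x\Xi(\xi)\,\mathrm d\xi,$$ under which $\mathrm dq\wedge\mathrm dp$ becomes $\omega$ and $h_1+b(t)h_2$ becomes $h_t$. *)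

theory Defs
  imports "HOL-Analysis.Analysis"
begin

text \<open>Points of the plane are pairs, both for the original variables \<open>(x, y)\<close> and for the
  canonical ones \<open>(q, p)\<close>. The indefinite integrals are represented by arbitrary antiderivatives:
  \<open>A\<close> of \<open>a\<close>, and \<open>F\<close> of \<open>\<Xi> = exp (- A)\<close>.\<close>

definition antiderivative_on :: "real set \<Rightarrow> (real \<Rightarrow> real) \<Rightarrow> (real \<Rightarrow> real) \<Rightarrow> bool" where
  "antiderivative_on I f F \<longleftrightarrow> (\<forall>x\<in>I. (F has_real_derivative f x) (at x))"

definition area_form :: "real \<times> real \<Rightarrow> real \<times> real \<Rightarrow> real" where
  "area_form v w = fst v * snd w - snd v * fst w"

definition omega :: "(real \<Rightarrow> real) \<Rightarrow> real \<times> real \<Rightarrow> real \<times> real \<Rightarrow> real \<times> real \<Rightarrow> real" where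
  "omega \<Xi> u v w = \<Xi> (fst u) / snd u * area_form v w"

definition partial_1 :: "(real \<times> real \<Rightarrow> real) \<Rightarrow> real \<times> real \<Rightarrow> real" where
  "partial_1 f u = deriv (\<lambda>s. f (s, snd u)) (fst u)"

definition partial_2 :: "(real \<times> real \<Rightarrow> real) \<Rightarrow> real \<times> real \<Rightarrow> real" where
  "partial_2 f u = deriv (\<lambda>s. f (fst u, s)) (snd u)"

definition poisson :: "(real \<Rightarrow> real) \<Rightarrow> (real \<times> real \<Rightarrow> real) \<Rightarrow> (real \<times> real \<Rightarrow> real)
    \<Rightarrow> real \<times> real \<Rightarrow> real" where
  "poisson \<Xi> f g u =
     snd u / \<Xi> (fst u) * (partial_1 f u * partial_2 g u - partial_2 f u * partial_1 g u)"

text \<open>Below, \<open>canonical_h2\<close> is the undeformed function \<open>q p\<close>, and \<open>canonical_h1\<close> serves both the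
  undeformed and the deformed case.\<close>

definition canonical_h1 :: "real \<times> real \<Rightarrow> real" where
  "canonical_h1 u = - fst u"

definition canonical_h2 :: "real \<times> real \<Rightarrow> real" where
  "canonical_h2 u = fst u * snd u"

definition canonical_hz2 :: "real \<Rightarrow> real \<times> real \<Rightarrow> real" where
  "canonical_hz2 z u = (exp (z * fst u) - 1) / z * snd u"

definition chart :: "(real \<Rightarrow> real) \<Rightarrow> (real \<Rightarrow> real) \<Rightarrow> real \<times> real \<Rightarrow> real \<times> real" where
  "chart \<Xi> F u = (- snd u * \<Xi> (fst u), 1 / (snd u * \<Xi> (fst u)) * F (fst u))"

text \<open>The pullback of \<open>dq \<and> dp\<close> along \<open>\<phi>\<close> is, at the point \<open>u\<close>, the bilinear form \<open>\<beta>\<close>.\<close>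

definition pulls_back_area_form_to ::
  "(real \<times> real \<Rightarrow> real \<times> real) \<Rightarrow> real \<times> real \<Rightarrow> (real \<times> real \<Rightarrow> real \<times> real \<Rightarrow> real) \<Rightarrow> bool" where
  "pulls_back_area_form_to \<phi> u \<beta> \<longleftrightarrow>
     (\<exists>D. (\<phi> has_derivative D) (at u) \<and> (\<forall>v w. area_form (D v) (D w) = \<beta> v w))"

definition buchdahl_hamiltonian ::
  "(real \<Rightarrow> real) \<Rightarrow> (real \<Rightarrow> real) \<Rightarrow> (real \<Rightarrow> real) \<Rightarrow> real \<Rightarrow> real \<times> real \<Rightarrow> real" where
  "buchdahl_hamiltonian b \<Xi> F t u = snd u * \<Xi> (fst u) - b t * F (fst u)"

definition deformed_h1 :: "(real \<Rightarrow> real) \<Rightarrow> (real \<Rightarrow> real) \<Rightarrow> real \<times> real \<Rightarrow> real" where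
  "deformed_h1 \<Xi> F = canonical_h1 \<circ> chart \<Xi> F"

definition deformed_h2 :: "real \<Rightarrow> (real \<Rightarrow> real) \<Rightarrow> (real \<Rightarrow> real) \<Rightarrow> real \<times> real \<Rightarrow> real" where
  "deformed_h2 z \<Xi> F = canonical_hz2 z \<circ> chart \<Xi> F"

definition deformed_hamiltonian ::
  "real \<Rightarrow> (real \<Rightarrow> real) \<Rightarrow> (real \<Rightarrow> real) \<Rightarrow> (real \<Rightarrow> real) \<Rightarrow> real \<Rightarrow> real \<times> real \<Rightarrow> real" where
  "deformed_hamiltonian z b \<Xi> F t =
     (\<lambda>v. canonical_h1 v + b t * canonical_hz2 z v) \<circ> chart \<Xi> F"

text \<open>\<open>(X, Y)\<close> solves \<open>x' = f t (x, y)\<close>, \<open>y' = g t (x, y)\<close> on the set \<open>T\<close> of times.\<close>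

definition solves_system :: "real set \<Rightarrow> (real \<Rightarrow> real \<times> real \<Rightarrow> real)
    \<Rightarrow> (real \<Rightarrow> real \<times> real \<Rightarrow> real) \<Rightarrow> (real \<Rightarrow> real) \<Rightarrow> (real \<Rightarrow> real) \<Rightarrow> bool" where
  "solves_system T f g X Y \<longleftrightarrow>
     (\<forall>t\<in>T. (X has_real_derivative f t (X t, Y t)) (at t) \<and>
            (Y has_real_derivative g t (X t, Y t)) (at t))"

definition solves_hamilton :: "real set \<Rightarrow> (real \<Rightarrow> real) \<Rightarrow> (real \<Rightarrow> real \<times> real \<Rightarrow> real)
    \<Rightarrow> (real \<Rightarrow> real) \<Rightarrow> (real \<Rightarrow> real) \<Rightarrow> bool" where
  "solves_hamilton T \<Xi> h X Y \<longleftrightarrow>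
     solves_system T (\<lambda>t. poisson \<Xi> fst (h t)) (\<lambda>t. poisson \<Xi> snd (h t)) X Y"

definition deformed_field_1 :: "(real \<Rightarrow> real) \<Rightarrow> real \<Rightarrow> (real \<Rightarrow> real) \<Rightarrow> (real \<Rightarrow> real)
    \<Rightarrow> real \<Rightarrow> real \<times> real \<Rightarrow> real" where
  "deformed_field_1 b z \<Xi> F t = (\<lambda>(x, y).
     y + b t * ((exp (z * y * \<Xi> x) - 1 - z * y * \<Xi> x) / (z * y * (\<Xi> x)^2))
           * exp (- z * y * \<Xi> x) * F x)"

definition deformed_field_2 :: "(real \<Rightarrow> real) \<Rightarrow> (real \<Rightarrow> real) \<Rightarrow> real \<Rightarrow> (real \<Rightarrow> real)
    \<Rightarrow> (real \<Rightarrow> real) \<Rightarrow> real \<Rightarrow> real \<times> real \<Rightarrow> real" where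
  "deformed_field_2 a b z \<Xi> F t = (\<lambda>(x, y).
     a x * y^2 + b t * exp (- z * y * \<Xi> x)
       * ((exp (z * y * \<Xi> x) - 1) / (z * \<Xi> x)
          + (exp (z * y * \<Xi> x) - 1 - z * y * \<Xi> x) / (z * (\<Xi> x)^2) * a x * F x))"

lemma canonical_hz2_tendsto: "((\<lambda>z. canonical_hz2 z u) \<longlongrightarrow> canonical_h2 u) (at 0)"
proof -
  have "((\<lambda>z. exp (z * fst u)) has_real_derivative fst u) (at 0)"
    by (auto intro!: derivative_eq_intros)
  then have "((\<lambda>z. (exp (z * fst u) - 1) / z) \<longlongrightarrow> fst u) (at 0)"
    by (simp add: has_field_derivative_iff)
  then show ?thesis
    unfolding canonical_hz2_def canonical_h2_def by (rule tendsto_mult_right)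
qed

lemma antiderivative_on_exists:
  fixes f :: "real \<Rightarrow> real"
  assumes "open I" "is_interval I" "continuous_on I f"
  shows "\<exists>F. antiderivative_on I f F"
proof (cases "I = {}")
  case True
  then show ?thesis by (simp add: antiderivative_on_def)
next
  case False
  then obtain c where c: "c \<in> I" by blast
  define F where "F x = (if c \<le> x then integral {c..x} f else - integral {x..c} f)" for x
  have "(F has_real_derivative f x) (at x)" if x: "x \<in> I" for x
  proof -
    have "min c x \<in> I" "max c x \<in> I" using c x by (auto simp: min_def max_def)
    then obtain e1 e2 where e: "e1 > 0" "cball (min c x) e1 \<subseteq> I" "e2 > 0" "cball (max c x) e2 \<subseteq> I"
      using \<open>open I\<close> by (meson open_contains_cball)
    define l r where "l = min c x - e1" and "r = max c x + e2"
    have lr: "l < c" "l < x" "c < r" "x < r"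
      using e(1,3) by (simp_all add: l_def r_def)
    have lI: "l \<in> I"
      using e(1) by (intro subsetD[OF e(2)]) (simp add: l_def dist_real_def)
    have rI: "r \<in> I"
      using e(3) by (intro subsetD[OF e(4)]) (simp add: r_def dist_real_def)
    have "{l..r} \<subseteq> I" by (intro subsetI) (rule mem_is_interval_1_I[OF assms(2) lI rI]; simp)
    then have cont: "continuous_on {l..r} f" using assms(3) continuous_on_subset by blast
    then have int: "f integrable_on {s..t}" if "l \<le> s" "t \<le> r" for s t
      using that by (intro integrable_continuous_real continuous_on_subset[OF cont]) simp
    have eq: "integral {l..s} f - integral {l..c} f = F s" if "s \<in> {l<..<r}" for s
    proof (cases "c \<le> s")
      case True
      have "integral {l..c} f + integral {c..s} f = integral {l..s} f"
        using that lr True by (intro Henstock_Kurzweil_Integration.integral_combine int) auto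
      then show ?thesis using True by (simp add: F_def)
    next
      case False
      have "integral {l..s} f + integral {s..c} f = integral {l..c} f"
        using that lr False by (intro Henstock_Kurzweil_Integration.integral_combine int) auto
      then show ?thesis using False by (simp add: F_def)
    qed
    have "((\<lambda>s. integral {l..s} f) has_real_derivative f x) (at x within {l..r})"
      using lr by (intro integral_has_real_derivative cont) auto
    then have "((\<lambda>s. integral {l..s} f) has_real_derivative f x) (at x)"
      using lr at_within_Icc_at[of l x r] by simp
    then have "((\<lambda>s. integral {l..s} f - integral {l..c} f) has_real_derivative f x) (at x)"
      by (auto intro!: derivative_eq_intros)
    then show ?thesis
      by (rule has_field_derivative_transform_within_open[of _ _ _ "{l<..<r}"]) (use lr in \<open>simp_all add: eq\<close>)
  qed
  then show ?thesis by (auto simp: antiderivative_on_def)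
qed

end

theory Submission
  imports Defs
begin

text \<open>In the variables \<open>(x, w)\<close> with \<open>w = y \<Xi>(x)\<close> the deformed functions are \<open>w\<close> and
  \<open>k(w) F(x)\<close>, where \<open>k(w) = (exp (- z w) - 1) / (z w)\<close>, and \<open>\<omega> = dx \<and> dw / y\<close>. All brackets then
  reduce to \<open>\<partial>w/\<partial>x = - a w\<close>, \<open>\<partial>w/\<partial>y = \<Xi>\<close>, \<open>F' = \<Xi>\<close> and the formula for \<open>k'\<close>.\<close>

definition book_factor :: "real \<Rightarrow> real \<Rightarrow> real" where
  "book_factor z w = (exp (- z * w) - 1) / (z * w)"

text \<open>The factor \<open>exp (- z * w)\<close> is pulled out because the target fields display
  it in this way.\<close>

definition book_factor_deriv :: "real \<Rightarrow> real \<Rightarrow> real" where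
  "book_factor_deriv z w = (exp (z * w) - 1 - z * w) / (z * w^2) * exp (- z * w)"

lemma book_factor_has_derivative:
  assumes "z \<noteq> 0" "w \<noteq> 0"
  shows "(book_factor z has_real_derivative book_factor_deriv z w) (at w)"
proof -
  \<comment> \<open>The quotient rule produces only \<open>exp (- z * w)\<close>, whereas
    \<open>book_factor_deriv\<close> also contains \<open>exp (z * w)\<close>; this product
    reconciles the two.\<close>
  have e: "exp (z * w) * exp (- (z * w)) = 1"
    by (simp flip: exp_add)
  have "((\<lambda>w. (exp (- z * w) - 1) / (z * w)) has_real_derivative
      (- z * exp (- z * w) * (z * w) - (exp (- z * w) - 1) * z) / (z * w * (z * w))) (at w)"
    using assms by (auto intro!: derivative_eq_intros)
  moreover have "(- z * exp (- z * w) * (z * w) - (exp (- z * w) - 1) * z) / (z * w * (z * w))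
      = book_factor_deriv z w"
    using assms e unfolding book_factor_deriv_def
    by (simp add: divide_simps power2_eq_square) (simp add: algebra_simps)
  ultimately show ?thesis
    unfolding book_factor_def[abs_def] by simp
qed

text \<open>The bracket is built from \<open>deriv\<close>, a choice operator, so its value is
  available only once derivatives along the coordinate lines are exhibited.\<close>

lemma poisson_eq:
  assumes "((\<lambda>s. f (s, y)) has_real_derivative f1) (at x)"
    and "((\<lambda>s. f (x, s)) has_real_derivative f2) (at y)"
    and "((\<lambda>s. g (s, y)) has_real_derivative g1) (at x)"
    and "((\<lambda>s. g (x, s)) has_real_derivative g2) (at y)"
  shows "poisson \<Xi> f g (x, y) = y / \<Xi> x * (f1 * g2 - f2 * g1)"
  using assms[THEN DERIV_imp_deriv] by (simp add: poisson_def partial_1_def partial_2_def)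

lemma poisson_fst_eq:
  assumes "((\<lambda>s. g (s, y)) has_real_derivative g1) (at x)"
    and "((\<lambda>s. g (x, s)) has_real_derivative g2) (at y)"
  shows "poisson \<Xi> fst g (x, y) = y / \<Xi> x * g2"
  using poisson_eq[OF _ _ assms, of fst 1 0 \<Xi>] by simp

lemma poisson_snd_eq:
  assumes "((\<lambda>s. g (s, y)) has_real_derivative g1) (at x)"
    and "((\<lambda>s. g (x, s)) has_real_derivative g2) (at y)"
  shows "poisson \<Xi> snd g (x, y) = - (y / \<Xi> x * g1)"
  using poisson_eq[OF _ _ assms, of snd 0 1 \<Xi>] by simp

lemma deformed_h1_eq: "deformed_h1 \<Xi> F (x, y) = y * \<Xi> x"
  by (simp add: deformed_h1_def canonical_h1_def chart_def)

text \<open>With \<open>q = - w\<close> and \<open>p = F / w\<close>, the \<open>1 / w\<close> of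
  \<open>p\<close> joins \<open>(exp (- z * w) - 1) / z\<close>. At \<open>w = 0\<close> both sides
  are 0, division by zero being 0.\<close>

lemma deformed_h2_eq: "deformed_h2 z \<Xi> F (x, y) = book_factor z (y * \<Xi> x) * F x"
  by (simp add: deformed_h2_def canonical_hz2_def chart_def book_factor_def)

lemma deformed_hamiltonian_eq:
  "deformed_hamiltonian z b \<Xi> F t u = deformed_h1 \<Xi> F u + b t * deformed_h2 z \<Xi> F u"
  by (simp add: deformed_hamiltonian_def deformed_h1_def deformed_h2_def)

text \<open>For \<open>w = y \<Xi>(x)\<close> the chart is \<open>(- w, F / w)\<close>. The
  \<open>F dw\<close> part of \<open>dp\<close> dies against \<open>dw\<close>, leaving
  \<open>(\<Xi> / w) dx \<and> dw\<close>; the \<open>dx\<close> part of \<open>dw\<close> dies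
  against \<open>dx\<close>, so the value \<open>d\<close> drops out and
  \<open>(\<Xi> / y) dx \<and> dy\<close> remains.\<close>

lemma area_form_chart:
  assumes \<Xi>: "(\<Xi> has_real_derivative d) (at x)" and F: "(F has_real_derivative \<Xi> x) (at x)"
    and nz: "\<Xi> x \<noteq> 0" "y \<noteq> 0"
  shows "pulls_back_area_form_to (chart \<Xi> F) (x, y) (omega \<Xi> (x, y))"
proof -
  \<comment> \<open>\<open>dw\<close> is the differential of \<open>w\<close> at
    \<open>(x, y)\<close>, and \<open>D\<close> is that of the chart by the quotient rule.\<close>
  define w where "w = y * \<Xi> x"
  define dw where "dw v = y * d * fst v + \<Xi> x * snd v" for v :: "real \<times> real"
  define D where "D v = (- dw v, \<Xi> x / w * fst v - F x / w^2 * dw v)" for v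
  have \<Xi>': "((\<lambda>u. \<Xi> (fst u)) has_derivative (\<lambda>v. d * fst v)) (at (x, y))"
    using \<Xi> by (intro has_derivative_compose[of fst fst "(x, y)" UNIV \<Xi> "\<lambda>h. d * h", simplified])
      (auto simp: has_field_derivative_def intro!: derivative_eq_intros)
  have F': "((\<lambda>u. F (fst u)) has_derivative (\<lambda>v. \<Xi> x * fst v)) (at (x, y))"
    using F by (intro has_derivative_compose[of fst fst "(x, y)" UNIV F "\<lambda>h. \<Xi> x * h", simplified])
      (auto simp: has_field_derivative_def intro!: derivative_eq_intros)
  have "((\<lambda>u. (- snd u * \<Xi> (fst u), 1 / (snd u * \<Xi> (fst u)) * F (fst u))) has_derivative D) (at (x, y))"
    using nz
    by (auto intro!: derivative_eq_intros \<Xi>' F' simp: D_def dw_def w_def fun_eq_iff field_simps power2_eq_square)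
  moreover have "area_form (D v) (D v') = omega \<Xi> (x, y) v v'" for v v'
    using nz by (simp add: area_form_def omega_def D_def dw_def w_def divide_simps power2_eq_square)
      (simp add: algebra_simps)
  ultimately show ?thesis
    unfolding pulls_back_area_form_to_def chart_def[abs_def] by blast
qed

text \<open>Brackets are computed point by point, so one point is fixed; \<open>\<alpha>\<close>
  stands for the value of \<open>a\<close> there.\<close>

context
  fixes \<Xi> F :: "real \<Rightarrow> real" and \<alpha> x y :: real
  assumes \<Xi>: "(\<Xi> has_real_derivative - \<alpha> * \<Xi> x) (at x)"
    and F: "(F has_real_derivative \<Xi> x) (at x)"
    and nz: "\<Xi> x \<noteq> 0" "y \<noteq> 0"
begin

lemma deformed_h1_derivs:
  "((\<lambda>s. deformed_h1 \<Xi> F (s, y)) has_real_derivative - \<alpha> * (y * \<Xi> x)) (at x)"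
  "((\<lambda>s. deformed_h1 \<Xi> F (x, s)) has_real_derivative \<Xi> x) (at y)"
  unfolding deformed_h1_eq by (auto intro!: derivative_eq_intros \<Xi>)

lemma deformed_h2_derivs:
  assumes z: "z \<noteq> 0"
  shows "((\<lambda>s. deformed_h2 z \<Xi> F (s, y)) has_real_derivative
      - \<alpha> * (y * \<Xi> x) * book_factor_deriv z (y * \<Xi> x) * F x + book_factor z (y * \<Xi> x) * \<Xi> x) (at x)"
    and "((\<lambda>s. deformed_h2 z \<Xi> F (x, s)) has_real_derivative
      \<Xi> x * book_factor_deriv z (y * \<Xi> x) * F x) (at y)"
proof -
  have k: "(book_factor z has_real_derivative book_factor_deriv z (y * \<Xi> x)) (at (y * \<Xi> x))"
    using nz by (intro book_factor_has_derivative z) simp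
  show "((\<lambda>s. deformed_h2 z \<Xi> F (s, y)) has_real_derivative
      - \<alpha> * (y * \<Xi> x) * book_factor_deriv z (y * \<Xi> x) * F x + book_factor z (y * \<Xi> x) * \<Xi> x) (at x)"
    unfolding deformed_h2_eq
    by (auto intro!: derivative_eq_intros DERIV_chain2[where g = "\<lambda>s. y * \<Xi> s", OF k] \<Xi> F)
  show "((\<lambda>s. deformed_h2 z \<Xi> F (x, s)) has_real_derivative
      \<Xi> x * book_factor_deriv z (y * \<Xi> x) * F x) (at y)"
    unfolding deformed_h2_eq
    by (auto intro!: derivative_eq_intros DERIV_chain2[where g = "\<lambda>s. s * \<Xi> x", OF k])
qed

text \<open>A function of \<open>w\<close> commutes with \<open>w\<close>, so all terms with
  \<open>k'\<close> cancel. What is left is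
  \<open>k(w) {F(x), w} = k(w) \<Xi> {x, w} = w k(w)\<close>, because
  \<open>{x, w} = y\<close>.\<close>

lemma poisson_deformed:
  assumes "z \<noteq> 0"
  shows "poisson \<Xi> (deformed_h2 z \<Xi> F) (deformed_h1 \<Xi> F) (x, y)
    = (exp (- z * deformed_h1 \<Xi> F (x, y)) - 1) / z"
proof -
  have "poisson \<Xi> (deformed_h2 z \<Xi> F) (deformed_h1 \<Xi> F) (x, y)
      = y * \<Xi> x * book_factor z (y * \<Xi> x)"
    unfolding poisson_eq[OF deformed_h2_derivs[OF assms] deformed_h1_derivs]
    using nz by (simp add: divide_simps) (simp add: algebra_simps)
  then show ?thesis
    using nz by (simp add: book_factor_def deformed_h1_eq)
qed

lemma deformed_hamiltonian_derivs:
  assumes "z \<noteq> 0"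
  shows "((\<lambda>s. deformed_hamiltonian z b \<Xi> F t (s, y)) has_real_derivative
      - \<alpha> * (y * \<Xi> x) + b t * (- \<alpha> * (y * \<Xi> x) * book_factor_deriv z (y * \<Xi> x) * F x
        + book_factor z (y * \<Xi> x) * \<Xi> x)) (at x)"
    and "((\<lambda>s. deformed_hamiltonian z b \<Xi> F t (x, s)) has_real_derivative
      \<Xi> x + b t * (\<Xi> x * book_factor_deriv z (y * \<Xi> x) * F x)) (at y)"
  unfolding deformed_hamiltonian_eq
  by (intro DERIV_add DERIV_cmult deformed_h1_derivs deformed_h2_derivs assms)+

lemma poisson_fst_deformed_hamiltonian:
  assumes z: "z \<noteq> 0"
  shows "poisson \<Xi> fst (deformed_hamiltonian z b \<Xi> F t) (x, y) = deformed_field_1 b z \<Xi> F t (x, y)"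
proof -
  have "poisson \<Xi> fst (deformed_hamiltonian z b \<Xi> F t) (x, y)
      = y + b t * (y * book_factor_deriv z (y * \<Xi> x)) * F x"
    unfolding poisson_fst_eq[OF deformed_hamiltonian_derivs[OF z]]
    using nz by (simp add: field_simps)
  \<comment> \<open>Here \<open>y / w^2 = 1 / (y \<Xi>^2)\<close>.\<close>
  also have "y * book_factor_deriv z (y * \<Xi> x)
      = (exp (z * y * \<Xi> x) - 1 - z * y * \<Xi> x) / (z * y * (\<Xi> x)^2) * exp (- z * y * \<Xi> x)"
    using nz z by (simp add: book_factor_deriv_def power2_eq_square mult.assoc)
  finally show ?thesis
    by (simp add: deformed_field_1_def mult.assoc)
qed

text \<open>The terms with \<open>a\<close> come from \<open>\<partial>w/\<partial>x\<close>, once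
  in \<open>w\<close> itself and once through \<open>k'\<close>; the remaining term comes from
  \<open>F' = \<Xi>\<close>.\<close>

lemma poisson_snd_deformed_hamiltonian:
  assumes z: "z \<noteq> 0" and a: "a x = \<alpha>"
  shows "poisson \<Xi> snd (deformed_hamiltonian z b \<Xi> F t) (x, y) = deformed_field_2 a b z \<Xi> F t (x, y)"
proof -
  have e: "exp (- z * y * \<Xi> x) * exp (z * y * \<Xi> x) = 1"
    by (simp flip: exp_add)
  \<comment> \<open>Uses
    \<open>1 - exp (- z * w) = exp (- z * w) * (exp (z * w) - 1)\<close>.\<close>
  have k: "- (y * book_factor z (y * \<Xi> x))
      = exp (- z * y * \<Xi> x) * ((exp (z * y * \<Xi> x) - 1) / (z * \<Xi> x))"
    using nz z e by (simp add: book_factor_def divide_simps) (simp add: algebra_simps)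
  have k': "y^2 * book_factor_deriv z (y * \<Xi> x)
      = exp (- z * y * \<Xi> x) * ((exp (z * y * \<Xi> x) - 1 - z * y * \<Xi> x) / (z * (\<Xi> x)^2))"
    using nz z by (simp add: book_factor_deriv_def power2_eq_square mult.assoc)
  have "poisson \<Xi> snd (deformed_hamiltonian z b \<Xi> F t) (x, y)
      = \<alpha> * y^2 + b t * (- (y * book_factor z (y * \<Xi> x))
          + y^2 * book_factor_deriv z (y * \<Xi> x) * \<alpha> * F x)"
    unfolding poisson_snd_eq[OF deformed_hamiltonian_derivs[OF z]]
    using nz by (simp add: divide_simps) (simp add: algebra_simps power2_eq_square)
  then show ?thesis
    unfolding k k' by (simp add: deformed_field_2_def a algebra_simps)
qed

text \<open>Ties the undeformed Hamiltonian to the generalized Buchdahl system: in the second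
  bracket \<open>F' = \<Xi>\<close> cancels the \<open>\<Xi>\<close> of the prefactor, turning
  \<open>- b F\<close> into \<open>b y\<close>.\<close>

lemma poisson_buchdahl_hamiltonian:
  "poisson \<Xi> fst (buchdahl_hamiltonian b \<Xi> F t) (x, y) = y"
  "poisson \<Xi> snd (buchdahl_hamiltonian b \<Xi> F t) (x, y) = \<alpha> * y^2 + b t * y"
proof -
  have d: "((\<lambda>s. buchdahl_hamiltonian b \<Xi> F t (s, y)) has_real_derivative
        - \<alpha> * (y * \<Xi> x) - b t * \<Xi> x) (at x)"
    "((\<lambda>s. buchdahl_hamiltonian b \<Xi> F t (x, s)) has_real_derivative \<Xi> x) (at y)"
    unfolding buchdahl_hamiltonian_def by (auto intro!: derivative_eq_intros \<Xi> F)
  show "poisson \<Xi> fst (buchdahl_hamiltonian b \<Xi> F t) (x, y) = y"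
    using nz by (simp add: poisson_fst_eq[OF d])
  show "poisson \<Xi> snd (buchdahl_hamiltonian b \<Xi> F t) (x, y) = \<alpha> * y^2 + b t * y"
    using nz by (simp add: poisson_snd_eq[OF d] field_simps power2_eq_square)
qed

end

text \<open>Only values of the fields along the curve matter, so identities valid for
  \<open>x \<in> I\<close>, \<open>y \<noteq> 0\<close> suffice for curves staying there.\<close>

lemma solves_system_cong:
  assumes "\<And>t. t \<in> T \<Longrightarrow> f t (X t, Y t) = f' t (X t, Y t)"
    and "\<And>t. t \<in> T \<Longrightarrow> g t (X t, Y t) = g' t (X t, Y t)"
  shows "solves_system T f g X Y \<longleftrightarrow> solves_system T f' g' X Y"
  using assms by (simp add: solves_system_def)

theorem proposition4p1:
  fixes I J :: "real set" and a b A F \<Xi> :: "real \<Rightarrow> real" and z :: real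
  assumes "open I" "is_interval I" "open J" "is_interval J"
    and "continuous_on I a" "continuous_on J b"
    and "z \<noteq> 0"
    and "antiderivative_on I a A"
    and "\<And>x. x \<in> I \<Longrightarrow> \<Xi> x = exp (- A x)"
    and "antiderivative_on I \<Xi> F"
  shows
    "\<comment> \<open>the change of variables turns \<open>dq \<and> dp\<close> into \<open>\<omega>\<close> and \<open>h\<^sub>1 + b(t) h\<^sub>2\<close> into \<open>h\<^sub>t\<close>\<close>
     (\<forall>x\<in>I. \<forall>y. y \<noteq> 0 \<longrightarrow>
        pulls_back_area_form_to (chart \<Xi> F) (x, y) (omega \<Xi> (x, y)) \<and>
        (\<forall>t\<in>J. canonical_h1 (chart \<Xi> F (x, y)) + b t * canonical_h2 (chart \<Xi> F (x, y))
                 = buchdahl_hamiltonian b \<Xi> F t (x, y)))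
     \<and>
     \<comment> \<open>(i)\<close>
     (\<forall>x\<in>I. \<forall>y. y \<noteq> 0 \<longrightarrow>
        (\<forall>t\<in>J. deformed_hamiltonian z b \<Xi> F t (x, y)
                 = deformed_h1 \<Xi> F (x, y) + b t * deformed_h2 z \<Xi> F (x, y)) \<and>
        deformed_h1 \<Xi> F (x, y) = y * \<Xi> x \<and>
        deformed_h2 z \<Xi> F (x, y) = (exp (- z * y * \<Xi> x) - 1) / (z * y * \<Xi> x) * F x \<and>
        poisson \<Xi> (deformed_h2 z \<Xi> F) (deformed_h1 \<Xi> F) (x, y)
          = (exp (- z * deformed_h1 \<Xi> F (x, y)) - 1) / z)
     \<and>
     \<comment> \<open>(ii)\<close>
     (\<forall>t\<in>J. \<forall>x\<in>I. \<forall>y. y \<noteq> 0 \<longrightarrow>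
        poisson \<Xi> fst (deformed_hamiltonian z b \<Xi> F t) (x, y)
          = deformed_field_1 b z \<Xi> F t (x, y) \<and>
        poisson \<Xi> snd (deformed_hamiltonian z b \<Xi> F t) (x, y)
          = deformed_field_2 a b z \<Xi> F t (x, y))
     \<and>
     (\<forall>T X Y. open T \<and> T \<subseteq> J \<and> (\<forall>t\<in>T. X t \<in> I \<and> Y t \<noteq> 0) \<longrightarrow>
        (solves_hamilton T \<Xi> (buchdahl_hamiltonian b \<Xi> F) X Y \<longleftrightarrow>
           solves_system T (\<lambda>t (x, y). y) (\<lambda>t (x, y). a x * y^2 + b t * y) X Y) \<and>
        (solves_hamilton T \<Xi> (deformed_hamiltonian z b \<Xi> F) X Y \<longleftrightarrow>
           solves_system T (deformed_field_1 b z \<Xi> F) (deformed_field_2 a b z \<Xi> F) X Y))"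
proof -
  have \<Xi>: "(\<Xi> has_real_derivative - a x * \<Xi> x) (at x)" if x: "x \<in> I" for x
  proof -
    have "(A has_real_derivative a x) (at x)"
      using assms(8) x by (simp add: antiderivative_on_def)
    then have "((\<lambda>x. exp (- A x)) has_real_derivative - a x * \<Xi> x) (at x)"
      by (auto intro!: derivative_eq_intros simp: assms(9)[OF x])
    \<comment> \<open>\<open>\<Xi>\<close> agrees with \<open>exp (- A x)\<close> only on
      \<open>I\<close>; openness of \<open>I\<close> makes this enough for the derivative.\<close>
    then show ?thesis
      by (rule has_field_derivative_transform_within_open[OF _ assms(1) x]) (simp add: assms(9))
  qed
  have F: "(F has_real_derivative \<Xi> x) (at x)" if "x \<in> I" for x
    using assms(10) that by (simp add: antiderivative_on_def)
  have nz: "\<Xi> x \<noteq> 0" if "x \<in> I" for x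
    using assms(9)[OF that] by simp
  \<comment> \<open>The derivative fact instantiates \<open>\<alpha>\<close> to \<open>a x\<close>,
    so \<open>refl\<close> settles the link between them.\<close>
  note field = poisson_fst_deformed_hamiltonian[OF \<Xi> F nz _ \<open>z \<noteq> 0\<close>]
    poisson_snd_deformed_hamiltonian[where a = a, OF \<Xi> F nz _ \<open>z \<noteq> 0\<close> refl]
  \<comment> \<open>In the product \<open>q p\<close> the nonzero \<open>w\<close> cancels, giving
    \<open>- F(x)\<close>.\<close>
  have "canonical_h1 (chart \<Xi> F (x, y)) + b t * canonical_h2 (chart \<Xi> F (x, y))
      = buchdahl_hamiltonian b \<Xi> F t (x, y)" if "x \<in> I" "y \<noteq> 0" for x y t
    using nz[OF that(1)] that(2)
    by (simp add: canonical_h1_def canonical_h2_def chart_def buchdahl_hamiltonian_def)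
  moreover have "deformed_h2 z \<Xi> F (x, y) = (exp (- z * y * \<Xi> x) - 1) / (z * y * \<Xi> x) * F x" for x y
    by (simp add: deformed_h2_eq book_factor_def mult.assoc)
  moreover have "solves_hamilton T \<Xi> (buchdahl_hamiltonian b \<Xi> F) X Y \<longleftrightarrow>
      solves_system T (\<lambda>t (x, y). y) (\<lambda>t (x, y). a x * y^2 + b t * y) X Y"
    if "\<forall>t\<in>T. X t \<in> I \<and> Y t \<noteq> 0" for T X Y
    unfolding solves_hamilton_def using that
    by (intro solves_system_cong) (simp_all add: poisson_buchdahl_hamiltonian[OF \<Xi> F nz])
  moreover have "solves_hamilton T \<Xi> (deformed_hamiltonian z b \<Xi> F) X Y \<longleftrightarrow>
      solves_system T (deformed_field_1 b z \<Xi> F) (deformed_field_2 a b z \<Xi> F) X Y"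
    if "\<forall>t\<in>T. X t \<in> I \<and> Y t \<noteq> 0" for T X Y
    unfolding solves_hamilton_def using that
    by (intro solves_system_cong) (simp_all add: field)
  ultimately show ?thesis
    using area_form_chart[OF \<Xi> F nz] poisson_deformed[OF \<Xi> F nz _ \<open>z \<noteq> 0\<close>] field
    by (simp add: deformed_hamiltonian_eq deformed_h1_eq)
qed

end
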